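(* Let $k\ge1$, $\Gamma=\mathbb{Z}^k$, $X=\mathbb{R}^{k+1}$, and let $G\subset\operatorname{Aff}(\mathbb{R}^{k+1})$ be the nilpotent group of affine transformations defined in the context. For any subgroup $\widetilde G$ of the affine transformation group $\operatorname{Aff}(\mathbb{R}^{k+1})$ containing $G$, the set $R(\Gamma,\widetilde G;X)$ is not open in $\operatorname{Hom}(\Gamma,\widetilde G)$; consequently both local rigidity (R) and stability (S) fail, i.e. there is $\varphi_0\in R(\Gamma,\widetilde G;X)$ such that $\widetilde G\cdot\varphi_0$ is not open in $\operatorname{Hom}(\Gamma,\widetilde G)$ and such that there is no open subset $V$ of $\operatorname{Hom}(\Gamma,\widetilde G)$ with $\varphi_0\in V\subset R(\Gamma,\widetilde G;X)$.
   Context: $G$ is the group of affine transformations of $\mathbb{R}^{k+1}=\mathbb{R}^k\oplus\mathbb{R}$ of the form $(\vec\xi,\xi_{k+1})\mapsto(\vec\xi+\xi_{k+1}\vec x+\vec y,\ \xi_{k+1}+z)$ with $\vec x,\vec y\in\mathbb{R}^k$, $z\in\mathbb{R}$; equivalently the group of matrices $\begin{pmatrix} I_k&\vec x&\vec y\\0&1&z\\0&0&1\end{pmatrix}$ of size $(k+2)\times(k+2)$. A subgroup $\widetilde G\subset\operatorname{Aff}(\mathbb{R}^{k+1})$ carries the topology induced from $\operatorname{Aff}(\mathbb{R}^{k+1})$. $\operatorname{Hom}(\Gamma,\widetilde G)$ is the set of group homomorphisms, with the topology induced from the embedding $\varphi\mapsto(\varphi(e_1),\dots,\varphi(e_k))$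 into $\widetilde G\times\cdots\times\widetilde G$ ($k$ factors), $e_1,\dots,e_k$ being the standard basis of $\mathbb{Z}^k$. $\widetilde G$ acts on it by conjugation, $(g\cdot\varphi)(\gamma)=g\varphi(\gamma)g^{-1}$. $R(\Gamma,\widetilde G;X)$ is the set of $\varphi\in\operatorname{Hom}(\Gamma,\widetilde G)$ such that $\varphi$ is injective and $\varphi(\Gamma)$ acts properly discontinuously and freely on $X$ (properly discontinuous: for every compact $S\subset X$ the set $\{\gamma\in\varphi(\Gamma):\gamma S\cap S\ne\emptyset\}$ is finite). For $\varphi_0\in R(\Gamma,\widetilde G;X)$: (R) says that $\widetilde G\cdot\varphi_0$ is open in $\operatorname{Hom}(\Gamma,\widetilde G)$; (S) says that there is an open subset $V$ of $\operatorname{Hom}(\Gamma,\widetilde G)$ with $\varphi_0\in V\subset R(\Gamma,\widetilde G;X)$. *)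

theory Defs
  imports "HOL-Analysis.Analysis" "HOL-Algebra.Group"
begin

text \<open>An element \<open>(A, b)\<close> stands for the affine transformation \<open>v \<mapsto> A v + b\<close>.
  In finite dimension the norm topology on pairs \<open>(A, b)\<close> is the usual topology of \<open>Aff\<close>.\<close>

type_synonym 'v aff = "('v \<Rightarrow>\<^sub>L 'v) \<times> 'v"

definition aff_act :: "'v::euclidean_space aff \<Rightarrow> 'v \<Rightarrow> 'v" where
  "aff_act g v = blinfun_apply (fst g) v + snd g"

definition Aff :: "'v::euclidean_space aff monoid" where
  "Aff = \<lparr>carrier = {g. bij (blinfun_apply (fst g))},
          mult = (\<lambda>g h. (fst g o\<^sub>L fst h, blinfun_apply (fst g) (snd h) + snd g)),
          one = (id_blinfun, 0)\<rparr>"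

definition nilG :: "((real ^ 'k::finite) \<times> real) aff set" where
  "nilG = {g \<in> carrier Aff. \<exists>x y z. \<forall>\<xi> t.
             aff_act g (\<xi>, t) = (\<xi> + t *\<^sub>R x + y, t + z)}"

definition Zk :: "(int ^ 'k::finite) monoid" where
  "Zk = \<lparr>carrier = UNIV, mult = (+), one = 0\<rparr>"

definition Hom :: "'v::euclidean_space aff set \<Rightarrow> (int ^ 'k::finite \<Rightarrow> 'v aff) set" where
  "Hom Gt = hom Zk (Aff\<lparr>carrier := Gt\<rparr>)"

definition Hom_topology ::
    "'v::euclidean_space aff set \<Rightarrow> (int ^ 'k::finite \<Rightarrow> 'v aff) topology" where
  "Hom_topology Gt =
     pullback_topology (Hom Gt) (\<lambda>\<phi> i. \<phi> (axis i 1))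
       (product_topology (\<lambda>_. top_of_set Gt) UNIV)"

definition conj_orbit ::
    "'v::euclidean_space aff set \<Rightarrow> (int ^ 'k::finite \<Rightarrow> 'v aff)
      \<Rightarrow> (int ^ 'k \<Rightarrow> 'v aff) set" where
  "conj_orbit Gt \<phi> =
     (\<lambda>g \<gamma>. g \<otimes>\<^bsub>Aff\<^esub> \<phi> \<gamma> \<otimes>\<^bsub>Aff\<^esub> inv\<^bsub>Aff\<^esub> g) ` Gt"

definition properly_discontinuous :: "'v::euclidean_space aff set \<Rightarrow> bool" where
  "properly_discontinuous H \<longleftrightarrow>
     (\<forall>S. compact S \<longrightarrow> finite {g \<in> H. aff_act g ` S \<inter> S \<noteq> {}})"

definition acts_freely :: "'v::euclidean_space aff set \<Rightarrow> bool" where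
  "acts_freely H \<longleftrightarrow> (\<forall>g\<in>H. \<forall>v. aff_act g v = v \<longrightarrow> g = \<one>\<^bsub>Aff\<^esub>)"

text \<open>The set \<open>R(\<Gamma>, Gt; X)\<close> for \<open>\<Gamma> = int ^ 'k\<close> and \<open>X\<close> the whole space \<open>'v\<close>.\<close>

definition Rset :: "'v::euclidean_space aff set \<Rightarrow> (int ^ 'k::finite \<Rightarrow> 'v aff) set" where
  "Rset Gt = {\<phi> \<in> Hom Gt. inj \<phi> \<and> properly_discontinuous (range \<phi>) \<and> acts_freely (range \<phi>)}"

lemma aff_act_mult: "aff_act (g \<otimes>\<^bsub>Aff\<^esub> h) v = aff_act g (aff_act h v)"
  by (simp add: aff_act_def Aff_def blinfun.add_right)

lemma aff_act_one: "aff_act \<one>\<^bsub>Aff\<^esub> v = v"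
  by (simp add: aff_act_def Aff_def)

lemma aff_act_inject: "aff_act g = aff_act h \<longleftrightarrow> g = h"
proof
  assume eq: "aff_act g = aff_act h"
  have s: "snd g = snd h"
    using fun_cong[OF eq, of 0] by (simp add: aff_act_def blinfun.zero_right)
  have "fst g = fst h"
    by (rule blinfun_eqI) (use eq s in \<open>simp add: aff_act_def fun_eq_iff\<close>)
  with s show "g = h" by (simp add: prod_eq_iff)
qed simp

lemma group_Aff: "group (Aff :: 'v::euclidean_space aff monoid)"
proof (rule groupI)
  fix g h k :: "'v aff"
  show "g \<otimes>\<^bsub>Aff\<^esub> h \<in> carrier Aff" if "g \<in> carrier Aff" "h \<in> carrier Aff"
  proof -
    have "blinfun_apply (fst g o\<^sub>L fst h) = blinfun_apply (fst g) \<circ> blinfun_apply (fst h)"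
      by (auto simp: fun_eq_iff)
    then show ?thesis using that by (simp add: Aff_def bij_comp)
  qed
  show "(\<one>\<^bsub>Aff\<^esub> :: 'v aff) \<in> carrier Aff"
    by (simp add: Aff_def bij_def inj_def surj_def)
  show "g \<otimes>\<^bsub>Aff\<^esub> h \<otimes>\<^bsub>Aff\<^esub> k = g \<otimes>\<^bsub>Aff\<^esub> (h \<otimes>\<^bsub>Aff\<^esub> k)"
    by (simp add: aff_act_inject[symmetric] fun_eq_iff aff_act_mult)
  show "\<one>\<^bsub>Aff\<^esub> \<otimes>\<^bsub>Aff\<^esub> g = g"
    by (simp add: aff_act_inject[symmetric] fun_eq_iff aff_act_mult aff_act_one)
  assume g: "g \<in> carrier Aff"
  let ?A = "blinfun_apply (fst g)"
  have b: "bij ?A" using g by (simp add: Aff_def)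
  have lin: "linear (inv_into UNIV ?A)"
  proof (rule linearI)
    have s: "?A (inv_into UNIV ?A v) = v" for v using b by (simp add: bij_is_surj surj_f_inv_f)
    have i: "v = w" if "?A v = ?A w" for v w using b that by (simp add: bij_is_inj inj_eq)
    show "inv_into UNIV ?A (v + w) = inv_into UNIV ?A v + inv_into UNIV ?A w" for v w
      by (rule i) (simp add: s blinfun.add_right)
    show "inv_into UNIV ?A (c *\<^sub>R v) = c *\<^sub>R inv_into UNIV ?A v" for c v
      by (rule i) (simp add: s blinfun.scaleR_right)
  qed
  let ?B = "Blinfun (inv_into UNIV ?A)"
  have B: "blinfun_apply ?B = inv_into UNIV ?A"
    using lin by (simp add: bounded_linear_Blinfun_apply linear_conv_bounded_linear)
  show "\<exists>y\<in>carrier Aff. y \<otimes>\<^bsub>Aff\<^esub> g = \<one>\<^bsub>Aff\<^esub>"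
  proof
    show "(?B, - ?B (snd g)) \<in> carrier Aff"
      by (simp add: Aff_def B bij_imp_bij_inv b)
    have "?B o\<^sub>L fst g = id_blinfun"
      by (rule blinfun_eqI) (use b in \<open>simp add: B bij_is_inj\<close>)
    then show "(?B, - ?B (snd g)) \<otimes>\<^bsub>Aff\<^esub> g = \<one>\<^bsub>Aff\<^esub>"
      by (simp add: Aff_def)
  qed
qed

lemma topspace_Hom_topology: "topspace (Hom_topology Gt) = Hom Gt"
  by (auto simp: Hom_topology_def topspace_pullback_topology Hom_def hom_def Zk_def PiE_def)

end

theory Submission
  imports Defs
begin

text \<open>Let \<open>\<phi>\<^sub>0\<close> send \<open>\<gamma>\<close> to the translation by \<open>(\<gamma>, 0)\<close>, and deform it inside the given nilpotent
  group to \<open>\<phi>\<^sub>e(\<gamma>) : (\<xi>, t) \<mapsto> (\<xi> + (e t + 1) \<gamma>, t)\<close>.  For \<open>e \<noteq> 0\<close> every \<open>\<phi>\<^sub>e(\<gamma>)\<close> fixes the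
  hyperplane \<open>t = -1/e\<close> pointwise, and this hyperplane escapes to infinity as \<open>e \<rightarrow> 0\<close>.  So each
  neighbourhood of \<open>\<phi>\<^sub>0\<close> contains homomorphisms that do not act freely, whereas conjugates of
  \<open>\<phi>\<^sub>0\<close> have no fixed points.\<close>

definition real_vec :: "int ^ 'k \<Rightarrow> real ^ 'k::finite" where
  "real_vec \<gamma> = (\<chi> i. real_of_int (\<gamma> $ i))"

lemma real_vec_add: "real_vec (a + b) = real_vec a + real_vec b"
  by (simp add: real_vec_def vec_eq_iff)

lemma real_vec_eq_0_iff [simp]: "real_vec a = 0 \<longleftrightarrow> a = 0"
  by (simp add: real_vec_def vec_eq_iff)

lemma inj_real_vec: "inj real_vec"
  by (auto simp: real_vec_def vec_eq_iff inj_def)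

text \<open>Each coordinate of such an \<open>a\<close> is an integer bounded by \<open>B\<close> in
  absolute value. This discreteness of the lattice is what makes the translation action properly
  discontinuous.\<close>

lemma finite_real_vec_norm_le: "finite {a :: int ^ 'k::finite. norm (real_vec a) \<le> B}"
proof (rule finite_subset)
  let ?F = "UNIV \<rightarrow>\<^sub>E {- \<lceil>B\<rceil>..\<lceil>B\<rceil>} :: ('k \<Rightarrow> int) set"
  show "finite (vec_lambda ` ?F)"
    by (intro finite_imageI finite_PiE) auto
  show "{a :: int ^ 'k. norm (real_vec a) \<le> B} \<subseteq> vec_lambda ` ?F"
  proof
    fix a :: "int ^ 'k"
    assume "a \<in> {a. norm (real_vec a) \<le> B}"
    then have "\<bar>real_of_int (a $ i)\<bar> \<le> B" for i
      using component_le_norm_cart[of "real_vec a" i] by (simp add: real_vec_def)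
    then have "a $ i \<in> {- \<lceil>B\<rceil>..\<lceil>B\<rceil>}" for i
      by (smt (verit) atLeastAtMost_iff le_of_int_ceiling of_int_le_iff of_int_minus abs_le_iff)
    then have "vec_nth a \<in> ?F" by auto
    then show "a \<in> vec_lambda ` ?F"
      by (metis image_eqI vec_nth_inverse)
  qed
qed

text \<open>The square-zero linear part of the deformation. Splitting it off makes
  \<open>shear_hom e \<gamma>\<close> affine in \<open>e\<close>, so continuity in \<open>e\<close>
  is immediate.\<close>

definition shear_part :: "'v \<Rightarrow> ('v::euclidean_space \<times> real) \<Rightarrow>\<^sub>L ('v \<times> real)" where
  "shear_part x = Blinfun (\<lambda>p. (snd p *\<^sub>R x, 0))"

lemma shear_part_apply [simp]: "shear_part x p = (snd p *\<^sub>R x, 0)"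
proof -
  have "bounded_linear (\<lambda>p :: 'a \<times> real. (snd p *\<^sub>R x, 0 :: real))"
    by (intro bounded_linear_Pair bounded_linear_zero
        bounded_linear_scaleR_const bounded_linear_snd)
  then show ?thesis
    by (simp add: shear_part_def bounded_linear_Blinfun_apply)
qed

definition shear_hom :: "real \<Rightarrow> int ^ 'k::finite \<Rightarrow> ((real ^ 'k) \<times> real) aff" where
  "shear_hom e \<gamma> = (id_blinfun + e *\<^sub>R shear_part (real_vec \<gamma>), (real_vec \<gamma>, 0))"

lemma aff_act_shear_hom:
  "aff_act (shear_hom e \<gamma>) (\<xi>, t) = (\<xi> + (e * t + 1) *\<^sub>R real_vec \<gamma>, t)"
  by (simp add: shear_hom_def aff_act_def blinfun.add_left blinfun.scaleR_left algebra_simps)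

lemma shear_hom_in_nilG: "shear_hom e \<gamma> \<in> nilG"
proof -
  let ?A = "\<lambda>e. blinfun_apply (id_blinfun + e *\<^sub>R shear_part (real_vec \<gamma>))"
  have "bij (?A e)"
    \<comment> \<open>\<open>shear_part\<close> squares to zero, so changing the sign of
      \<open>e\<close> inverts the linear part.\<close>
    by (rule o_bij[of "?A (- e)"])
       (auto simp: fun_eq_iff blinfun.add_left blinfun.diff_left blinfun.scaleR_left algebra_simps)
  then have "shear_hom e \<gamma> \<in> carrier Aff"
    by (simp add: shear_hom_def Aff_def)
  moreover have "\<forall>\<xi> t. aff_act (shear_hom e \<gamma>) (\<xi>, t)
      = (\<xi> + t *\<^sub>R (e *\<^sub>R real_vec \<gamma>) + real_vec \<gamma>, t + 0)"
    by (simp add: aff_act_shear_hom algebra_simps)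
  ultimately show ?thesis
    unfolding nilG_def by blast
qed

text \<open>The coordinate \<open>t\<close> is left fixed, so two successive maps scale by the same
  factor \<open>e * t + 1\<close> and their displacements add up.\<close>

lemma shear_hom_in_Hom:
  assumes "nilG \<subseteq> Gt"
  shows "shear_hom e \<in> Hom Gt"
proof -
  have "shear_hom e (a + b) = shear_hom e a \<otimes>\<^bsub>Aff\<^esub> shear_hom e b" for a b :: "int ^ 'a"
    by (auto simp: aff_act_inject[symmetric] fun_eq_iff aff_act_mult aff_act_shear_hom
        real_vec_add algebra_simps)
  moreover have "shear_hom e a \<in> Gt" for a
    using assms shear_hom_in_nilG by blast
  ultimately show ?thesis
    by (simp add: Hom_def hom_def Zk_def)
qed

text \<open>The topology on \<open>Hom Gt\<close> is pulled back from the values on the standard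
  basis, so continuity has to be checked only there.\<close>

lemma continuous_map_shear_hom:
  assumes "nilG \<subseteq> Gt"
  shows "continuous_map euclideanreal (Hom_topology Gt) shear_hom"
  unfolding Hom_topology_def
proof (rule continuous_map_pullback')
  have "continuous_map euclideanreal (top_of_set Gt)
      (\<lambda>e. shear_hom e (axis i 1))" for i :: 'a
  proof -
    have "continuous_on UNIV (\<lambda>e. shear_hom e (axis i 1))"
      unfolding shear_hom_def by (intro continuous_intros)
    then show ?thesis
      using assms shear_hom_in_nilG by (auto simp: continuous_map_in_subtopology)
  qed
  then show "continuous_map euclideanreal (product_topology (\<lambda>_. top_of_set Gt) UNIV)
      ((\<lambda>\<phi> i. \<phi> (axis i 1)) \<circ> shear_hom)"
    by (simp add: continuous_map_componentwise_UNIV o_def)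
  show "topspace euclideanreal \<subseteq> shear_hom -` Hom Gt"
    using shear_hom_in_Hom[OF assms] by auto
qed

text \<open>Both negative claims rest on this: a set that contains \<open>shear_hom 0\<close> but no
  other \<open>shear_hom e\<close> cannot be open.\<close>

lemma shear_hom_in_open_set:
  assumes "nilG \<subseteq> Gt" "openin (Hom_topology Gt) V" "shear_hom 0 \<in> V"
  obtains e where "e \<noteq> 0" "shear_hom e \<in> V"
proof -
  have "open {e. shear_hom e \<in> V}"
    using openin_continuous_map_preimage[OF continuous_map_shear_hom assms(2)] assms(1) by simp
  then obtain d where "d > 0" "ball 0 d \<subseteq> {e. shear_hom e \<in> V}"
    using assms(3) open_contains_ball[of "{e. shear_hom e \<in> V}"] by auto
  then have "shear_hom (d / 2) \<in> V" by (auto simp: subset_iff)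
  then show thesis using that[of "d / 2"] \<open>d > 0\<close> by simp
qed

lemma shear_hom_fixed_point:
  assumes "e \<noteq> 0"
  shows "aff_act (shear_hom e \<gamma>) (\<xi>, - 1 / e) = (\<xi>, - 1 / e)"
  using assms by (simp add: aff_act_shear_hom)

lemma shear_hom_0_eq_one_iff: "shear_hom 0 \<gamma> = \<one>\<^bsub>Aff\<^esub> \<longleftrightarrow> \<gamma> = 0"
  by (auto simp: aff_act_inject[symmetric] fun_eq_iff aff_act_one aff_act_shear_hom)

lemma inj_shear_hom: "inj (shear_hom e)"
  using inj_real_vec by (auto simp: inj_def shear_hom_def)

lemma shear_hom_notin_Rset:
  assumes "e \<noteq> 0"
  shows "shear_hom e \<notin> Rset Gt"
proof
  assume "shear_hom e \<in> Rset Gt"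
  then have "acts_freely (range (shear_hom e :: int ^ 'a \<Rightarrow> _))" by (simp add: Rset_def)
  then have "shear_hom e \<gamma> = \<one>\<^bsub>Aff\<^esub>" for \<gamma> :: "int ^ 'a"
    using shear_hom_fixed_point[OF assms] unfolding acts_freely_def by blast
  \<comment> \<open>Injectivity survives the deformation, so two distinct elements cannot both act
    as the identity. Here \<open>1\<close> is the all-ones vector, nonzero because the index type is
    nonempty.\<close>
  then have "(0 :: int ^ 'a) = 1"
    using inj_shear_hom[of e] by (metis injD)
  then show False by (simp add: vec_eq_iff)
qed

lemma shear_hom_0_no_fixed_point:
  assumes "\<gamma> \<noteq> 0"
  shows "aff_act (shear_hom 0 \<gamma>) v \<noteq> v"
  using assms by (cases v) (simp add: aff_act_shear_hom)

lemma shear_hom_0_in_Rset: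
  assumes "nilG \<subseteq> Gt"
  shows "shear_hom 0 \<in> Rset Gt"
proof -
  have "properly_discontinuous (range (shear_hom 0 :: int ^ 'a \<Rightarrow> _))"
    unfolding properly_discontinuous_def
  proof (intro allI impI)
    fix S :: "((real ^ 'a) \<times> real) set"
    assume "compact S"
    then obtain B where B: "\<And>v. v \<in> S \<Longrightarrow> norm v \<le> B"
      using compact_imp_bounded[of S] by (auto simp: bounded_iff)
    \<comment> \<open>If the translate of \<open>S\<close> meets \<open>S\<close>, then
      \<open>real_vec \<gamma>\<close> is a difference of first components of two points of
      \<open>S\<close>.\<close>
    have "norm (real_vec \<gamma>) \<le> 2 * B"
      if meets: "aff_act (shear_hom 0 \<gamma>) ` S \<inter> S \<noteq> {}" for \<gamma> :: "int ^ 'a"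
    proof -
      obtain \<xi> t where "(\<xi>, t) \<in> S" "(\<xi> + real_vec \<gamma>, t) \<in> S"
        using meets by (auto simp: aff_act_shear_hom)
      then have "norm \<xi> \<le> B" "norm (\<xi> + real_vec \<gamma>) \<le> B"
        using B[of "(\<xi>, t)"] B[of "(\<xi> + real_vec \<gamma>, t)"]
          norm_fst_le[of \<xi> t] norm_fst_le[of "\<xi> + real_vec \<gamma>" t] by linarith+
      then show ?thesis
        using norm_triangle_ineq4[of "\<xi> + real_vec \<gamma>" \<xi>] by simp
    qed
    then have "{g \<in> range (shear_hom 0). aff_act g ` S \<inter> S \<noteq> {}}
        \<subseteq> shear_hom 0 ` {\<gamma> :: int ^ 'a. norm (real_vec \<gamma>) \<le> 2 * B}"
      by blast
    then show "finite {g \<in> range (shear_hom 0 :: int ^ 'a \<Rightarrow> _). aff_act g ` S \<inter> S \<noteq> {}}"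
      by (rule finite_subset) (intro finite_imageI finite_real_vec_norm_le)
  qed
  moreover have "acts_freely (range (shear_hom 0 :: int ^ 'a \<Rightarrow> _))"
    unfolding acts_freely_def
    using shear_hom_0_no_fixed_point shear_hom_0_eq_one_iff by blast
  ultimately show ?thesis
    using shear_hom_in_Hom[OF assms] inj_shear_hom by (simp add: Rset_def)
qed

text \<open>The inverse of \<open>g\<close> carries fixed points of the conjugate to fixed points of
  \<open>h\<close>.\<close>

lemma aff_act_conj_fixed_point:
  assumes "g \<in> carrier Aff"
    and "aff_act (g \<otimes>\<^bsub>Aff\<^esub> h \<otimes>\<^bsub>Aff\<^esub> inv\<^bsub>Aff\<^esub> g) v = v"
  shows "aff_act h (aff_act (inv\<^bsub>Aff\<^esub> g) v) = aff_act (inv\<^bsub>Aff\<^esub> g) v"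
proof -
  have "aff_act (inv\<^bsub>Aff\<^esub> g) (aff_act g w) = w" for w
    using group.l_inv[OF group_Aff assms(1)] by (metis aff_act_mult aff_act_one)
  then show ?thesis
    using assms(2) by (metis aff_act_mult)
qed

lemma shear_hom_notin_conj_orbit:
  assumes "subgroup Gt Aff" "e \<noteq> 0"
  shows "shear_hom e \<notin> conj_orbit Gt (shear_hom 0)"
proof
  assume "shear_hom e \<in> conj_orbit Gt (shear_hom 0)"
  then obtain g where g: "g \<in> Gt"
    and eq: "shear_hom e = (\<lambda>\<gamma>. g \<otimes>\<^bsub>Aff\<^esub> shear_hom 0 \<gamma> \<otimes>\<^bsub>Aff\<^esub> inv\<^bsub>Aff\<^esub> g)"
    by (auto simp: conj_orbit_def)
  \<comment> \<open>A point of the hyperplane fixed by every \<open>shear_hom e \<gamma>\<close>.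
    Moved by the inverse of \<open>g\<close>, it would be fixed by a nontrivial translation.\<close>
  define w where "w = (0 :: real ^ 'a, - 1 / e)"
  have "g \<in> carrier Aff" using g assms(1) subgroup.mem_carrier by fast
  moreover have "aff_act (g \<otimes>\<^bsub>Aff\<^esub> shear_hom 0 1 \<otimes>\<^bsub>Aff\<^esub> inv\<^bsub>Aff\<^esub> g) w = w"
    using shear_hom_fixed_point[OF assms(2), of "1 :: int ^ 'a" 0] fun_cong[OF eq, of 1]
    by (simp add: w_def)
  ultimately have "aff_act (shear_hom 0 1) (aff_act (inv\<^bsub>Aff\<^esub> g) w) = aff_act (inv\<^bsub>Aff\<^esub> g) w"
    by (rule aff_act_conj_fixed_point)
  moreover have "(1 :: int ^ 'a) \<noteq> 0" by (simp add: vec_eq_iff)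
  ultimately show False
    using shear_hom_0_no_fixed_point by blast
qed

theorem mainTheorem4:
  fixes Gt :: "((real ^ 'k::finite) \<times> real) aff set"
  assumes "subgroup Gt Aff"
    and "nilG \<subseteq> Gt"
  shows "\<not> openin (Hom_topology Gt)
             (Rset Gt :: (int ^ 'k \<Rightarrow> ((real ^ 'k) \<times> real) aff) set)
       \<and> (\<exists>\<phi>\<^sub>0 \<in> (Rset Gt :: (int ^ 'k \<Rightarrow> ((real ^ 'k) \<times> real) aff) set).
            \<not> openin (Hom_topology Gt) (conj_orbit Gt \<phi>\<^sub>0)
          \<and> \<not> (\<exists>V. openin (Hom_topology Gt) V \<and> \<phi>\<^sub>0 \<in> V \<and> V \<subseteq> Rset Gt))"
proof -
  let ?\<phi> = "shear_hom 0 :: int ^ 'k \<Rightarrow> ((real ^ 'k) \<times> real) aff"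
  have R: "?\<phi> \<in> Rset Gt"
    using assms(2) by (rule shear_hom_0_in_Rset)
  have S: "\<not> (\<exists>V. openin (Hom_topology Gt) V \<and> ?\<phi> \<in> V \<and> V \<subseteq> Rset Gt)"
    by (metis shear_hom_in_open_set[OF assms(2)] shear_hom_notin_Rset subsetD)
  \<comment> \<open>Were the orbit open, it would now be a neighbourhood of \<open>?\<phi>\<close>
    and contain some \<open>shear_hom e\<close> with nonzero \<open>e\<close>.\<close>
  have "?\<phi> \<in> conj_orbit Gt ?\<phi>"
  proof -
    interpret Aff: group "Aff :: ((real ^ 'k) \<times> real) aff monoid" by (rule group_Aff)
    have "?\<phi> \<gamma> \<in> carrier Aff" for \<gamma>
      using shear_hom_in_nilG[of 0 \<gamma>] by (simp add: nilG_def)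
    then have "?\<phi> = (\<lambda>\<gamma>. \<one>\<^bsub>Aff\<^esub> \<otimes>\<^bsub>Aff\<^esub> ?\<phi> \<gamma> \<otimes>\<^bsub>Aff\<^esub> inv\<^bsub>Aff\<^esub> \<one>\<^bsub>Aff\<^esub>)"
      by simp
    then show ?thesis
      unfolding conj_orbit_def using subgroup.one_closed[OF assms(1)] by (rule image_eqI)
  qed
  then have "\<not> openin (Hom_topology Gt) (conj_orbit Gt ?\<phi>)"
    using shear_hom_in_open_set[OF assms(2)] shear_hom_notin_conj_orbit[OF assms(1)] by metis
  \<comment> \<open>That \<open>Rset Gt\<close> is not open is \<open>S\<close> with
    \<open>V\<close> taken to be \<open>Rset Gt\<close> itself.\<close>
  with R S show ?thesis by blast
qed

end
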